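(* Let $\lambda>0$, let $X$ be gamma distributed with parameters $(1/2,\lambda)$, let $N$ be a standard Gaussian random variable independent of $X$, and for $r>0$ let $$X_r=\left(\sqrt{rX}+\frac{N}{\sqrt{2\lambda}}\right)^2 .$$ Then for all $r>0$, $$I(X;X_r)\ge\frac12\log(1+r)-\log 2,$$ and $$\lim_{r\to+\infty}\frac{I(X;X_r)}{\frac12\log(1+r)}=1 .$$
   Context: The gamma distribution with parameters $(a,b)$ has density $\frac{b^{a}}{\Gamma(a)}x^{a-1}e^{-bx}$ on $(0,\infty)$. Mutual information: $I(X;Y)=E\big[\log\frac{dP^{X,Y}}{d(P^X\otimes P^Y)}(X,Y)\big]$, where $P^{X,Y}$ is the joint law of $(X,Y)$ and $P^X,P^Y$ are its marginals. *)

theory Defs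
  imports "HOL-Probability.Probability"
begin

(* The library only has the Erlang case, where the shape parameter is a positive integer. *)
definition gamma_density :: "real \<Rightarrow> real \<Rightarrow> real \<Rightarrow> real" where
  "gamma_density a b x =
     (if 0 < x then b powr a / Gamma a * x powr (a - 1) * exp (- b * x) else 0)"

(* The logarithm is natural, hence base exp 1. The underlying KL_divergence is a Bochner
   integral, so the value is 0 if the log-density is not integrable under the joint law or
   the joint law has no density; a nonzero value excludes both. *)
definition mutual_info :: "'a measure \<Rightarrow> ('a \<Rightarrow> real) \<Rightarrow> ('a \<Rightarrow> real) \<Rightarrow> real" where
  "mutual_info M X Y = prob_space.mutual_information M (exp 1) borel borel X Y"

end

theory Submission
  imports Defs "HOL-Real_Asymp.Real_Asymp"
begin

text \<open>
  Write \<open>I\<close> for the mutual information of \<open>X\<close> and \<open>X\<^sub>r\<close>. The theorem follows from the two-sided bound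
  \<open>ln (1 + r) / 2 - ln 2 \<le> I \<le> ln (1 + r) / 2 + 1/2\<close>, valid for all \<open>r > 0\<close>
  (\<open>mutual_info_bounds\<close>): its left half is the first claim, and dividing by \<open>ln (1 + r) / 2\<close> gives the limit.

  The gamma law with parameters \<open>1/2\<close> and \<open>\<beta>\<close> is the law of the square of a centred Gaussian with
  variance \<open>1 / (2 \<beta>)\<close> (\<open>gamma_half_eq_squared_normal\<close>). Up to a sign that squaring removes,
  \<open>X\<^sub>r\<close> is therefore the square of a sum of two independent Gaussians, so it is again gamma distributed,
  with parameters \<open>1/2\<close> and \<open>\<beta> / (1 + r)\<close> (\<open>distr_Y\<close>), and the joint law has an explicit density
  with respect to the product of the marginals (\<open>distr_XY\<close>), namely

    \<open>sqrt (1 + r) exp (- \<beta> r x - \<beta> r y / (1 + r)) cosh (2 \<beta> sqrt (r x y))\<close>.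

  The mutual information is the mean of the logarithm of this density. By \<open>E X = 1 / (2 \<beta>)\<close> and
  \<open>E X\<^sub>r = (1 + r) / (2 \<beta>)\<close> it equals \<open>ln (1 + r) / 2 - r + E (ln (cosh Z))\<close>, where
  \<open>Z = 2 \<beta> sqrt (r X) (sqrt (r X) + N / sqrt (2 \<beta>))\<close> has mean \<open>r\<close>. Since
  \<open>Z - ln 2 \<le> ln (cosh Z) \<le> Z + N\<^sup>2 / 2\<close> (\<open>ln_cosh_bounds\<close>), the terms \<open>r\<close> cancel and the bounds follow.
\<close>

section \<open>Squares of centred Gaussian variables\<close>

lemma nn_integral_reflect:
  fixes f :: "real \<Rightarrow> ennreal"
  assumes [measurable]: "f \<in> borel_measurable borel"
  shows "(\<integral>\<^sup>+x. f (- x) \<partial>lborel) = (\<integral>\<^sup>+x. f x \<partial>lborel)"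
  using nn_integral_real_affine[of f "-1" 0] by simp

lemma nn_integral_even:
  fixes f :: "real \<Rightarrow> ennreal"
  assumes [measurable]: "f \<in> borel_measurable borel" and even: "\<And>x. f (- x) = f x"
  shows "(\<integral>\<^sup>+x. f x \<partial>lborel) = 2 * (\<integral>\<^sup>+x. f x * indicator {0..} x \<partial>lborel)"
proof -
  have "(\<integral>\<^sup>+x. f x \<partial>lborel) = (\<integral>\<^sup>+x. f x * indicator {0..} x + f x * indicator {0..} (- x) \<partial>lborel)"
    by (rule nn_integral_cong_AE, use AE_lborel_singleton[of "0::real"] in eventually_elim)
       (auto split: split_indicator)
  also have "\<dots> = (\<integral>\<^sup>+x. f x * indicator {0..} x \<partial>lborel) + (\<integral>\<^sup>+x. f x * indicator {0..} (- x) \<partial>lborel)"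
    by (rule nn_integral_add) measurable
  also have "(\<integral>\<^sup>+x. f x * indicator {0..} (- x) \<partial>lborel) = (\<integral>\<^sup>+x. f x * indicator {0..} x \<partial>lborel)"
    using nn_integral_reflect[of "\<lambda>x. f x * indicator {0..} x"] by (simp add: even)
  finally show ?thesis by (simp add: mult_2)
qed

text \<open>
  Substitution on compact intervals and monotone convergence: the half line is exhausted by the
  intervals from 0 to \<open>(n + 1)\<^sup>2\<close>, whose preimages in the half line are those from 0 to \<open>n + 1\<close>.
\<close>

lemma nn_integral_substitution_square:
  fixes f :: "real \<Rightarrow> ennreal"
  assumes [measurable]: "f \<in> borel_measurable borel"
  shows "(\<integral>\<^sup>+x. f x * indicator {0..} x \<partial>lborel) =
         (\<integral>\<^sup>+u. f (u\<^sup>2) * ennreal (2 * u) * indicator {0..} u \<partial>lborel)"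
proof -
  have SUP: "(SUP n. c * indicator {0..h n} x) = c * indicator {0..} x"
    if "filterlim h at_top sequentially" for c :: ennreal and h :: "nat \<Rightarrow> real" and x :: real
  proof (rule antisym)
    have "\<forall>\<^sub>F n in sequentially. x \<le> h n"
      using that unfolding filterlim_at_top by blast
    then obtain n where "x \<le> h n"
      by (auto simp: eventually_sequentially)
    then have "c * indicator {0..} x \<le> c * indicator {0..h n} x"
      by (auto split: split_indicator)
    then show "c * indicator {0..} x \<le> (SUP n. c * indicator {0..h n} x)"
      by (rule SUP_upper2[OF UNIV_I])
  qed (auto intro!: SUP_least mult_left_mono split: split_indicator)
  have lim1: "filterlim (\<lambda>n. real (Suc n)) at_top sequentially"
    by (rule filterlim_compose[OF filterlim_real_sequentially filterlim_Suc])
  then have lim2: "filterlim (\<lambda>n. (real (Suc n))\<^sup>2) at_top sequentially"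
    by (rule filterlim_pow_at_top[rotated]) simp
  have "(\<integral>\<^sup>+x. f x * indicator {0..} x \<partial>lborel) = (\<integral>\<^sup>+x. (SUP n. f x * indicator {0..(real (Suc n))\<^sup>2} x) \<partial>lborel)"
    using SUP[OF lim2] by simp
  also have "\<dots> = (SUP n. \<integral>\<^sup>+x. f x * indicator {0..(real (Suc n))\<^sup>2} x \<partial>lborel)"
    by (intro nn_integral_monotone_convergence_SUP)
       (auto simp: incseq_def le_fun_def simp del: of_nat_Suc intro!: mult_left_mono
             intro: order_trans power_mono split: split_indicator)
  also have "\<dots> = (SUP n. \<integral>\<^sup>+u. f (u\<^sup>2) * ennreal (2 * u) * indicator {0..real (Suc n)} u \<partial>lborel)"
  proof (intro SUP_cong refl)
    fix n
    have "(\<integral>\<^sup>+x. f x * indicator {0\<^sup>2..(real (Suc n))\<^sup>2} x \<partial>lborel) =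
      (\<integral>\<^sup>+u. f (u\<^sup>2) * ennreal (2 * u) * indicator {0..real (Suc n)} u \<partial>lborel)"
      by (rule nn_integral_substitution_aux[of f 0 "real (Suc n)" "\<lambda>u. u\<^sup>2" "\<lambda>u. 2 * u"])
         (auto intro!: derivative_eq_intros continuous_intros)
    then show "(\<integral>\<^sup>+x. f x * indicator {0..(real (Suc n))\<^sup>2} x \<partial>lborel) =
      (\<integral>\<^sup>+u. f (u\<^sup>2) * ennreal (2 * u) * indicator {0..real (Suc n)} u \<partial>lborel)"
      by (simp only: zero_power2)
  qed
  also have "\<dots> = (\<integral>\<^sup>+u. (SUP n. f (u\<^sup>2) * ennreal (2 * u) * indicator {0..real (Suc n)} u) \<partial>lborel)"
    by (intro nn_integral_monotone_convergence_SUP[symmetric])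
       (auto simp: incseq_def le_fun_def intro!: mult_left_mono split: split_indicator)
  also have "\<dots> = (\<integral>\<^sup>+u. f (u\<^sup>2) * ennreal (2 * u) * indicator {0..} u \<partial>lborel)"
    using SUP[OF lim1] by simp
  finally show ?thesis .
qed

definition squared_normal :: "real \<Rightarrow> real measure" where
  "squared_normal \<sigma> = distr (density lborel (normal_density 0 \<sigma>)) borel (\<lambda>u. u\<^sup>2)"

lemma sets_squared_normal [measurable_cong, simp]: "sets (squared_normal \<sigma>) = sets borel"
  by (simp add: squared_normal_def)

lemma prob_space_squared_normal: "0 < \<sigma> \<Longrightarrow> prob_space (squared_normal \<sigma>)"
  unfolding squared_normal_def
  by (intro prob_space.prob_space_distr prob_space_normal_density) measurable

lemma nn_integral_squared_normal:
  assumes [measurable]: "g \<in> borel_measurable borel"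
  shows "(\<integral>\<^sup>+x. g x \<partial>squared_normal \<sigma>) = (\<integral>\<^sup>+u. ennreal (normal_density 0 \<sigma> u) * g (u\<^sup>2) \<partial>lborel)"
  by (simp add: squared_normal_def nn_integral_distr nn_integral_density)

lemma AE_squared_normal_nonneg: "AE x in squared_normal \<sigma>. 0 \<le> x"
  unfolding squared_normal_def by (subst AE_distr_iff) simp_all

lemma normal_density_variance_inverse:
  assumes "\<beta> > 0"
  shows "normal_density \<mu> (1 / sqrt (2 * \<beta>)) x = sqrt (\<beta> / pi) * exp (- \<beta> * (x - \<mu>)\<^sup>2)"
  using assms by (simp add: normal_density_def power_divide real_sqrt_divide field_simps)

text \<open>
  This is the classical fact that shape \<open>1/2\<close> belongs, up to scaling, to the chi-squared law
  with one degree of freedom. It makes input and output of the channel objects of the same kind and turns all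
  integrals against a gamma law into Gaussian ones.
\<close>

lemma gamma_half_eq_squared_normal:
  assumes "\<beta> > 0"
  shows "density lborel (gamma_density (1/2) \<beta>) = squared_normal (1 / sqrt (2 * \<beta>))"
proof (rule measure_eqI)
  show "sets (density lborel (gamma_density (1/2) \<beta>)) = sets (squared_normal (1 / sqrt (2 * \<beta>)))"
    by simp
next
  fix A assume "A \<in> sets (density lborel (gamma_density (1/2) \<beta>))"
  then have [measurable]: "A \<in> sets borel" by simp
  have [measurable]: "gamma_density (1/2) \<beta> \<in> borel_measurable borel"
    unfolding gamma_density_def[abs_def] by measurable
  have dens: "gamma_density (1/2) \<beta> (u\<^sup>2) * (2 * u) = 2 * normal_density 0 (1 / sqrt (2 * \<beta>)) u"
    if "u > 0" for u
  proof -
    have "(u\<^sup>2) powr (-1/2) = 1 / u"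
      using that by (simp add: powr_powr powr_minus_divide flip: powr_numeral)
    then show ?thesis
      using that assms
      by (simp add: gamma_density_def Gamma_one_half_real powr_half_sqrt normal_density_variance_inverse
          real_sqrt_divide)
  qed
  have "emeasure (density lborel (gamma_density (1/2) \<beta>)) A
      = (\<integral>\<^sup>+x. (ennreal (gamma_density (1/2) \<beta> x) * indicator A x) * indicator {0..} x \<partial>lborel)"
    by (subst emeasure_density)
       (auto simp: gamma_density_def intro!: nn_integral_cong split: split_indicator)
  also have "\<dots> = (\<integral>\<^sup>+u. (ennreal (gamma_density (1/2) \<beta> (u\<^sup>2)) * indicator A (u\<^sup>2)) * ennreal (2 * u) * indicator {0..} u \<partial>lborel)"
    by (rule nn_integral_substitution_square[of "\<lambda>x. ennreal (gamma_density (1/2) \<beta> x) * indicator A x"]) measurable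
  also have "\<dots> = (\<integral>\<^sup>+u. 2 * (ennreal (normal_density 0 (1 / sqrt (2 * \<beta>)) u) * indicator A (u\<^sup>2) * indicator {0..} u) \<partial>lborel)"
  proof (rule nn_integral_cong_AE, use AE_lborel_singleton[of "0::real"] in eventually_elim)
    \<comment> \<open>at 0 the Jacobian vanishes and cannot cancel the pole of the density\<close>
    fix u :: real assume "u \<noteq> 0"
    show "ennreal (gamma_density (1/2) \<beta> (u\<^sup>2)) * indicator A (u\<^sup>2) * ennreal (2 * u) * indicator {0..} u =
        2 * (ennreal (normal_density 0 (1 / sqrt (2 * \<beta>)) u) * indicator A (u\<^sup>2) * indicator {0..} u)"
    proof (cases "u > 0")
      case True
      have "ennreal (gamma_density (1/2) \<beta> (u\<^sup>2)) * ennreal (2 * u) = 2 * ennreal (normal_density 0 (1 / sqrt (2 * \<beta>)) u)"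
      proof -
        have "ennreal (gamma_density (1/2) \<beta> (u\<^sup>2)) * ennreal (2 * u) = ennreal (gamma_density (1/2) \<beta> (u\<^sup>2) * (2 * u))"
          using True by (intro ennreal_mult''[symmetric]) simp
        then show ?thesis by (simp only: dens[OF True]) (simp add: ennreal_mult')
      qed
      then show ?thesis using True by (auto split: split_indicator)
    qed (use \<open>u \<noteq> 0\<close> in auto)
  qed
  also have "\<dots> = 2 * (\<integral>\<^sup>+u. ennreal (normal_density 0 (1 / sqrt (2 * \<beta>)) u) * indicator A (u\<^sup>2) * indicator {0..} u \<partial>lborel)"
    by (rule nn_integral_cmult) measurable
  also have "\<dots> = (\<integral>\<^sup>+u. ennreal (normal_density 0 (1 / sqrt (2 * \<beta>)) u) * indicator A (u\<^sup>2) \<partial>lborel)"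
    by (rule nn_integral_even[symmetric]) (auto simp: normal_density_def)
  also have "\<dots> = emeasure (squared_normal (1 / sqrt (2 * \<beta>))) A"
    by (simp flip: nn_integral_squared_normal)
  finally show "emeasure (density lborel (gamma_density (1/2) \<beta>)) A
      = emeasure (squared_normal (1 / sqrt (2 * \<beta>))) A" .
qed

section \<open>The density of the joint law with respect to the product of its marginals\<close>

text \<open>
  The density at \<open>(x, y)\<close> of the joint law of \<open>X\<close> and \<open>X\<^sub>r\<close> relative to the product of the marginal
  laws. It is the conditional density of \<open>X\<^sub>r\<close> given \<open>X = x\<close>, a scaled noncentral chi-squared density,
  divided by the density of the gamma law with parameters \<open>1/2\<close> and \<open>\<beta> / (1 + r)\<close>; the powers of
  \<open>y\<close> cancel, and the \<open>cosh\<close> remains because squaring forgets the sign of the Gaussian.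
\<close>

definition likelihood_ratio :: "real \<Rightarrow> real \<Rightarrow> real \<Rightarrow> real \<Rightarrow> real" where
  "likelihood_ratio \<beta> r x y =
     sqrt (1 + r) * exp (- \<beta> * r * x - \<beta> * r / (1 + r) * y) * cosh (2 * \<beta> * sqrt (r * x * y))"

lemma measurable_cosh [measurable]: "cosh \<in> borel_measurable (borel :: real measure)"
  unfolding cosh_def by measurable

lemma measurable_likelihood_ratio [measurable]:
  assumes [measurable]: "f \<in> borel_measurable M" "g \<in> borel_measurable M"
  shows "(\<lambda>z. likelihood_ratio \<beta> r (f z) (g z)) \<in> borel_measurable M"
  unfolding likelihood_ratio_def by measurable

lemma likelihood_ratio_pos: "r > 0 \<Longrightarrow> 0 < likelihood_ratio \<beta> r x y"
  by (simp add: likelihood_ratio_def)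

lemma cosh_mult_abs: "cosh (c * \<bar>z\<bar>) = cosh (c * z)" for c z :: real
  by (cases "z \<ge> 0") simp_all

lemma normal_density_mirror_sum:
  assumes "\<beta> > 0"
  shows "normal_density \<mu> (1 / sqrt (2 * \<beta>)) x + normal_density (- \<mu>) (1 / sqrt (2 * \<beta>)) x
       = 2 * sqrt (\<beta> / pi) * exp (- \<beta> * (x\<^sup>2 + \<mu>\<^sup>2)) * cosh (2 * \<beta> * (\<mu> * x))"
proof -
  have "exp (- \<beta> * (x - c)\<^sup>2) = exp (- \<beta> * (x\<^sup>2 + c\<^sup>2)) * exp (2 * \<beta> * (c * x))" for c
    by (simp add: power2_eq_square algebra_simps flip: exp_add)
  from this[of \<mu>] this[of "-\<mu>"] show ?thesis
    unfolding normal_density_variance_inverse[OF assms] by (simp add: cosh_def algebra_simps)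
qed

text \<open>
  Writing \<open>y = w\<^sup>2\<close> avoids densities with a pole: the right-hand side is the even part of the
  Gaussian density of \<open>sqrt (r x) + N / sqrt (2 \<beta>)\<close>, and only the even part matters for the law of
  the square.
\<close>

lemma likelihood_ratio_times_output_density:
  assumes "\<beta> > 0" "r > 0" "x \<ge> 0"
  shows "normal_density 0 (1 / sqrt (2 * (\<beta> / (1 + r)))) w * likelihood_ratio \<beta> r x (w\<^sup>2)
       = (normal_density (sqrt (r * x)) (1 / sqrt (2 * \<beta>)) w
          + normal_density (- sqrt (r * x)) (1 / sqrt (2 * \<beta>)) w) / 2"
proof -
  have pos: "\<beta> / (1 + r) > 0" using assms by simp
  have c: "cosh (2 * \<beta> * sqrt (r * x * w\<^sup>2)) = cosh (2 * \<beta> * (sqrt (r * x) * w))"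
    using cosh_mult_abs[of "2 * \<beta>" "sqrt (r * x) * w"] assms by (simp add: real_sqrt_mult abs_mult)
  have s: "sqrt (\<beta> / (1 + r) / pi) * sqrt (1 + r) = sqrt (\<beta> / pi)"
    using assms by (simp flip: real_sqrt_mult)
  have "- (\<beta> / (1 + r)) * (w - 0)\<^sup>2 + (- \<beta> * r * x - \<beta> * r / (1 + r) * w\<^sup>2)
      = - \<beta> * (w\<^sup>2 + (sqrt (r * x))\<^sup>2)"
    using assms by (simp add: divide_simps) algebra
  then have e: "exp (- (\<beta> / (1 + r)) * (w - 0)\<^sup>2) * exp (- \<beta> * r * x - \<beta> * r / (1 + r) * w\<^sup>2)
      = exp (- \<beta> * (w\<^sup>2 + (sqrt (r * x))\<^sup>2))"
    by (metis exp_add)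
  have "normal_density 0 (1 / sqrt (2 * (\<beta> / (1 + r)))) w * likelihood_ratio \<beta> r x (w\<^sup>2)
      = (sqrt (\<beta> / (1 + r) / pi) * sqrt (1 + r))
        * (exp (- (\<beta> / (1 + r)) * (w - 0)\<^sup>2) * exp (- \<beta> * r * x - \<beta> * r / (1 + r) * w\<^sup>2))
        * cosh (2 * \<beta> * sqrt (r * x * w\<^sup>2))"
    unfolding likelihood_ratio_def normal_density_variance_inverse[OF pos] by (simp only: mult_ac)
  also have "\<dots> = sqrt (\<beta> / pi) * exp (- \<beta> * (w\<^sup>2 + (sqrt (r * x))\<^sup>2)) * cosh (2 * \<beta> * (sqrt (r * x) * w))"
    by (simp only: c s e)
  finally show ?thesis
    unfolding normal_density_mirror_sum[OF assms(1)] by simp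
qed

text \<open>
  The same product, read as a function of the square root \<open>u\<close> of the input with the output \<open>w\<^sup>2\<close>
  held fixed. Completing the square in \<open>u\<close> leaves a mixture of two Gaussian densities without any
  further factor, hence a function with integral 1; this is what identifies the output law.
\<close>

lemma likelihood_ratio_times_input_density:
  assumes "\<beta> > 0" "r > 0"
  shows "normal_density 0 (1 / sqrt (2 * \<beta>)) u * likelihood_ratio \<beta> r (u\<^sup>2) (w\<^sup>2)
       = (normal_density (sqrt r * w / (1 + r)) (1 / sqrt (2 * (\<beta> * (1 + r)))) u
          + normal_density (- (sqrt r * w / (1 + r))) (1 / sqrt (2 * (\<beta> * (1 + r)))) u) / 2"
proof -
  have pos: "\<beta> * (1 + r) > 0" using assms by simp
  have "sqrt (r * u\<^sup>2 * w\<^sup>2) = \<bar>sqrt r * w * u\<bar>"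
    using assms by (simp add: real_sqrt_mult abs_mult)
  then have "cosh (2 * \<beta> * sqrt (r * u\<^sup>2 * w\<^sup>2)) = cosh (2 * \<beta> * (sqrt r * w * u))"
    by (simp only: cosh_mult_abs)
  moreover have "2 * (\<beta> * (1 + r)) * (sqrt r * w / (1 + r) * u) = 2 * \<beta> * (sqrt r * w * u)"
    using assms by (simp add: field_simps)
  ultimately have c: "cosh (2 * \<beta> * sqrt (r * u\<^sup>2 * w\<^sup>2))
      = cosh (2 * (\<beta> * (1 + r)) * (sqrt r * w / (1 + r) * u))"
    by simp
  have s: "sqrt (\<beta> / pi) * sqrt (1 + r) = sqrt (\<beta> * (1 + r) / pi)"
    by (simp flip: real_sqrt_mult)
  have "- \<beta> * (u - 0)\<^sup>2 + (- \<beta> * r * u\<^sup>2 - \<beta> * r / (1 + r) * w\<^sup>2)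
      = - (\<beta> * (1 + r)) * (u\<^sup>2 + (sqrt r * w / (1 + r))\<^sup>2)"
    using assms by (simp add: power_divide power_mult_distrib divide_simps) algebra
  then have e: "exp (- \<beta> * (u - 0)\<^sup>2) * exp (- \<beta> * r * u\<^sup>2 - \<beta> * r / (1 + r) * w\<^sup>2)
      = exp (- (\<beta> * (1 + r)) * (u\<^sup>2 + (sqrt r * w / (1 + r))\<^sup>2))"
    by (metis exp_add)
  have "normal_density 0 (1 / sqrt (2 * \<beta>)) u * likelihood_ratio \<beta> r (u\<^sup>2) (w\<^sup>2)
      = (sqrt (\<beta> / pi) * sqrt (1 + r))
        * (exp (- \<beta> * (u - 0)\<^sup>2) * exp (- \<beta> * r * u\<^sup>2 - \<beta> * r / (1 + r) * w\<^sup>2))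
        * cosh (2 * \<beta> * sqrt (r * u\<^sup>2 * w\<^sup>2))"
    unfolding likelihood_ratio_def normal_density_variance_inverse[OF assms(1)] by (simp only: mult_ac)
  also have "\<dots> = sqrt (\<beta> * (1 + r) / pi) * exp (- (\<beta> * (1 + r)) * (u\<^sup>2 + (sqrt r * w / (1 + r))\<^sup>2))
        * cosh (2 * (\<beta> * (1 + r)) * (sqrt r * w / (1 + r) * u))"
    by (simp only: c s e)
  finally show ?thesis
    unfolding normal_density_mirror_sum[OF pos] by simp
qed

section \<open>The law of the output and the mutual information\<close>

lemma nn_integral_likelihood_ratio_input:
  assumes "\<beta> > 0" "r > 0"
  shows "(\<integral>\<^sup>+x. ennreal (likelihood_ratio \<beta> r x (w\<^sup>2)) \<partial>squared_normal (1 / sqrt (2 * \<beta>))) = 1"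
proof -
  define n where "n c = normal_density (c * (sqrt r * w / (1 + r))) (1 / sqrt (2 * (\<beta> * (1 + r))))" for c
  have pos: "0 < 1 / sqrt (2 * (\<beta> * (1 + r)))" using assms by simp
  have int: "integrable lborel (n c)" "integral\<^sup>L lborel (n c) = 1" for c
    unfolding n_def by (rule integrable_normal_density[OF pos] integral_normal_density[OF pos])+
  have [simp]: "0 \<le> n c u" for c u by (simp add: n_def)
  have "(\<integral>\<^sup>+x. ennreal (likelihood_ratio \<beta> r x (w\<^sup>2)) \<partial>squared_normal (1 / sqrt (2 * \<beta>)))
      = (\<integral>\<^sup>+u. ennreal (normal_density 0 (1 / sqrt (2 * \<beta>)) u * likelihood_ratio \<beta> r (u\<^sup>2) (w\<^sup>2)) \<partial>lborel)"
    by (simp add: nn_integral_squared_normal flip: ennreal_mult')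
  also have "\<dots> = (\<integral>\<^sup>+u. ennreal ((n 1 u + n (-1) u) / 2) \<partial>lborel)"
    by (simp only: likelihood_ratio_times_input_density[OF assms] n_def mult_1 mult_minus1)
  also have "\<dots> = ennreal (\<integral>u. (n 1 u + n (-1) u) / 2 \<partial>lborel)"
    by (intro nn_integral_eq_integral) (auto simp: int)
  also have "(\<integral>u. (n 1 u + n (-1) u) / 2 \<partial>lborel) = 1"
    by (simp add: int)
  finally show ?thesis by simp
qed

text \<open>
  The noisy root \<open>sqrt (r x) + N / sqrt (2 \<beta>)\<close> and its reflection have the same square, so its density
  may be replaced by the even part, which is the density of the centred Gaussian whose square is
  the output law, times the likelihood ratio.
\<close>

lemma nn_integral_channel_output:
  fixes g :: "real \<Rightarrow> ennreal"
  assumes "\<beta> > 0" "r > 0" "x \<ge> 0" and [measurable]: "g \<in> borel_measurable borel"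
  shows "(\<integral>\<^sup>+n. g ((sqrt (r * x) + n / sqrt (2 * \<beta>))\<^sup>2) \<partial>density lborel std_normal_density)
       = (\<integral>\<^sup>+y. ennreal (likelihood_ratio \<beta> r x y) * g y \<partial>squared_normal (1 / sqrt (2 * (\<beta> / (1 + r)))))"
proof -
  define \<sigma> where "\<sigma> = 1 / sqrt (2 * \<beta>)"
  have \<sigma>: "\<sigma> > 0" using assms by (simp add: \<sigma>_def)
  define A where "A \<mu> = (\<integral>\<^sup>+w. ennreal (normal_density \<mu> \<sigma> w) * g (w\<^sup>2) \<partial>lborel)" for \<mu>
  have A: "A (- \<mu>) = A \<mu>" for \<mu>
  proof -
    have "normal_density \<mu> \<sigma> (- w) = normal_density (- \<mu>) \<sigma> w" for w
      by (simp add: normal_density_def power2_eq_square algebra_simps)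
    then show ?thesis
      using nn_integral_reflect[of "\<lambda>w. ennreal (normal_density \<mu> \<sigma> w) * g (w\<^sup>2)"]
      by (simp add: A_def)
  qed
  have std: "\<sigma> * normal_density \<mu> \<sigma> (\<mu> + \<sigma> * n) = std_normal_density n" for \<mu> n
    using \<sigma> by (simp add: normal_density_def real_sqrt_mult power_mult_distrib)
  have "(\<integral>\<^sup>+n. g ((\<mu> + n / sqrt (2 * \<beta>))\<^sup>2) \<partial>density lborel std_normal_density) = A \<mu>" for \<mu>
  proof -
    have "A \<mu> = ennreal \<sigma> * (\<integral>\<^sup>+n. ennreal (normal_density \<mu> \<sigma> (\<mu> + \<sigma> * n)) * g ((\<mu> + \<sigma> * n)\<^sup>2) \<partial>lborel)"
      unfolding A_def using \<sigma> by (subst nn_integral_real_affine[where c=\<sigma> and t=\<mu>]) auto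
    also have "\<dots> = (\<integral>\<^sup>+n. ennreal \<sigma> * (ennreal (normal_density \<mu> \<sigma> (\<mu> + \<sigma> * n)) * g ((\<mu> + \<sigma> * n)\<^sup>2)) \<partial>lborel)"
      by (rule nn_integral_cmult[symmetric]) measurable
    also have "\<dots> = (\<integral>\<^sup>+n. ennreal (std_normal_density n) * g ((\<mu> + \<sigma> * n)\<^sup>2) \<partial>lborel)"
      using \<sigma> by (simp add: std flip: mult.assoc ennreal_mult')
    finally show ?thesis by (simp add: nn_integral_density \<sigma>_def mult.commute)
  qed
  then have "(\<integral>\<^sup>+n. g ((sqrt (r * x) + n / sqrt (2 * \<beta>))\<^sup>2) \<partial>density lborel std_normal_density) = A (sqrt (r * x))" .
  also have "\<dots> = (A (sqrt (r * x)) + A (- sqrt (r * x))) / 2"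
    by (simp add: A mult_divide_eq_ennreal mult.commute[of 2] flip: mult_2)
  also have "\<dots> = (\<integral>\<^sup>+w. (ennreal (normal_density (sqrt (r * x)) \<sigma> w) * g (w\<^sup>2) +
       ennreal (normal_density (- sqrt (r * x)) \<sigma> w) * g (w\<^sup>2)) / 2 \<partial>lborel)"
    unfolding A_def by (simp add: nn_integral_add nn_integral_divide)
  also have "\<dots> = (\<integral>\<^sup>+w. ennreal ((normal_density (sqrt (r * x)) \<sigma> w + normal_density (- sqrt (r * x)) \<sigma> w) / 2) * g (w\<^sup>2) \<partial>lborel)"
    by (intro nn_integral_cong) (simp add: ennreal_plus ennreal_divide_numeral[symmetric] distrib_left ennreal_times_divide mult.commute)
  also have "\<dots> = (\<integral>\<^sup>+w. ennreal (normal_density 0 (1 / sqrt (2 * (\<beta> / (1 + r)))) w * likelihood_ratio \<beta> r x (w\<^sup>2)) * g (w\<^sup>2) \<partial>lborel)"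
    by (simp only: likelihood_ratio_times_output_density[OF assms(1-3)] \<sigma>_def)
  also have "\<dots> = (\<integral>\<^sup>+y. ennreal (likelihood_ratio \<beta> r x y) * g y \<partial>squared_normal (1 / sqrt (2 * (\<beta> / (1 + r)))))"
    by (simp add: nn_integral_squared_normal ennreal_mult' mult.assoc)
  finally show ?thesis .
qed

text \<open>
  A single value of \<open>r\<close> is enough, because the bounds on the mutual information hold for each
  \<open>r\<close> separately.
\<close>

locale gamma_channel = prob_space +
  fixes X N :: "'a \<Rightarrow> real" and \<beta> r :: real
  assumes \<beta>: "\<beta> > 0" and r: "r > 0"
    and X: "distributed M lborel X (gamma_density (1/2) \<beta>)"
    and N: "distributed M lborel N std_normal_density"
    and indep: "indep_var borel X borel N"
begin

definition Y :: "'a \<Rightarrow> real" where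
  "Y \<omega> = (sqrt (r * X \<omega>) + N \<omega> / sqrt (2 * \<beta>))\<^sup>2"

abbreviation "law_X \<equiv> squared_normal (1 / sqrt (2 * \<beta>))"
abbreviation "law_Y \<equiv> squared_normal (1 / sqrt (2 * (\<beta> / (1 + r))))"

sublocale PX: prob_space law_X
  using \<beta> by (intro prob_space_squared_normal) simp
sublocale PY: prob_space law_Y
  using \<beta> r by (intro prob_space_squared_normal) simp
sublocale PXY: pair_prob_space law_X law_Y ..

lemma measurable_X [measurable]: "X \<in> borel_measurable M"
  using distributed_measurable[OF X] by simp

lemma measurable_N [measurable]: "N \<in> borel_measurable M"
  using distributed_measurable[OF N] by simp

lemma measurable_Y [measurable]: "Y \<in> borel_measurable M"
  unfolding Y_def[abs_def] by measurable

lemma distr_X: "distr M borel X = law_X"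
proof -
  have "distr M borel X = distr M lborel X" by (rule distr_cong) auto
  then show ?thesis
    using distributed_distr_eq_density[OF X] gamma_half_eq_squared_normal[OF \<beta>] by simp
qed

lemma distr_N: "distr M borel N = density lborel std_normal_density"
proof -
  have "distr M borel N = distr M lborel N" by (rule distr_cong) auto
  then show ?thesis
    using distributed_distr_eq_density[OF N] by simp
qed

lemma X_nonneg: "AE \<omega> in M. 0 \<le> X \<omega>"
proof -
  have "AE x in distr M borel X. 0 \<le> x"
    unfolding distr_X by (rule AE_squared_normal_nonneg)
  then show ?thesis by (subst (asm) AE_distr_iff) simp_all
qed

text \<open>
  This already says that the joint law has the likelihood ratio as density with respect to the
  product of \<open>law_X\<close> and \<open>law_Y\<close>; that \<open>law_Y\<close> is the law of the output is deduced from it afterwards,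
  by exchanging the integrals and integrating out the input.
\<close>

lemma nn_integral_joint:
  fixes g :: "real \<times> real \<Rightarrow> ennreal"
  assumes [measurable]: "g \<in> borel_measurable (borel \<Otimes>\<^sub>M borel)"
  shows "(\<integral>\<^sup>+\<omega>. g (X \<omega>, Y \<omega>) \<partial>M)
       = (\<integral>\<^sup>+x. \<integral>\<^sup>+y. ennreal (likelihood_ratio \<beta> r x y) * g (x, y) \<partial>law_Y \<partial>law_X)"
proof -
  interpret PN: prob_space "density lborel std_normal_density"
    by (rule prob_space_normal_density) simp
  define h where "h = (\<lambda>(x, n). g (x, (sqrt (r * x) + n / sqrt (2 * \<beta>))\<^sup>2))"
  have [measurable]: "h \<in> borel_measurable (borel \<Otimes>\<^sub>M borel)"
    unfolding h_def by measurable
  have joint: "distr M (borel \<Otimes>\<^sub>M borel) (\<lambda>\<omega>. (X \<omega>, N \<omega>)) = law_X \<Otimes>\<^sub>M density lborel std_normal_density"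
    using indep by (simp add: indep_var_distribution_eq distr_X distr_N)
  have "(\<integral>\<^sup>+\<omega>. g (X \<omega>, Y \<omega>) \<partial>M) = (\<integral>\<^sup>+\<omega>. h (X \<omega>, N \<omega>) \<partial>M)"
    by (simp add: h_def Y_def)
  also have "\<dots> = (\<integral>\<^sup>+z. h z \<partial>(law_X \<Otimes>\<^sub>M density lborel std_normal_density))"
    by (simp add: nn_integral_distr flip: joint)
  also have "\<dots> = (\<integral>\<^sup>+x. \<integral>\<^sup>+n. h (x, n) \<partial>density lborel std_normal_density \<partial>law_X)"
    by (rule PN.nn_integral_fst[symmetric]) measurable
  also have "\<dots> = (\<integral>\<^sup>+x. \<integral>\<^sup>+y. ennreal (likelihood_ratio \<beta> r x y) * g (x, y) \<partial>law_Y \<partial>law_X)"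
  proof (rule nn_integral_cong_AE, use AE_squared_normal_nonneg in eventually_elim)
    fix x :: real assume "0 \<le> x"
    then show "(\<integral>\<^sup>+n. h (x, n) \<partial>density lborel std_normal_density)
        = (\<integral>\<^sup>+y. ennreal (likelihood_ratio \<beta> r x y) * g (x, y) \<partial>law_Y)"
      unfolding h_def using nn_integral_channel_output[OF \<beta> r, of x "\<lambda>y. g (x, y)"] by simp
  qed
  finally show ?thesis .
qed

lemma distr_Y: "distr M borel Y = law_Y"
proof (rule measure_eqI)
  fix A assume "A \<in> sets (distr M borel Y)"
  then have [measurable]: "A \<in> sets borel" by simp
  have "emeasure (distr M borel Y) A = (\<integral>\<^sup>+\<omega>. indicator A (Y \<omega>) \<partial>M)"
    by (simp add: nn_integral_distr flip: nn_integral_indicator)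
  also have "\<dots> = (\<integral>\<^sup>+x. \<integral>\<^sup>+y. ennreal (likelihood_ratio \<beta> r x y) * indicator A y \<partial>law_Y \<partial>law_X)"
    using nn_integral_joint[of "\<lambda>z. indicator A (snd z)"] by simp
  also have "\<dots> = (\<integral>\<^sup>+y. \<integral>\<^sup>+x. ennreal (likelihood_ratio \<beta> r x y) * indicator A y \<partial>law_X \<partial>law_Y)"
    by (rule PXY.Fubini'[symmetric]) measurable
  also have "\<dots> = (\<integral>\<^sup>+y. (\<integral>\<^sup>+x. ennreal (likelihood_ratio \<beta> r x y) \<partial>law_X) * indicator A y \<partial>law_Y)"
    by (simp add: nn_integral_multc)
  also have "\<dots> = (\<integral>\<^sup>+y. indicator A y \<partial>law_Y)"
  proof (rule nn_integral_cong_AE, use AE_squared_normal_nonneg in eventually_elim)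
    fix y :: real assume "0 \<le> y"
    then show "(\<integral>\<^sup>+x. ennreal (likelihood_ratio \<beta> r x y) \<partial>law_X) * indicator A y = indicator A y"
      using nn_integral_likelihood_ratio_input[OF \<beta> r, of "sqrt y"] by simp
  qed
  finally show "emeasure (distr M borel Y) A = emeasure law_Y A" by simp
qed simp

lemma distr_XY:
  "distr M (borel \<Otimes>\<^sub>M borel) (\<lambda>\<omega>. (X \<omega>, Y \<omega>))
   = density (law_X \<Otimes>\<^sub>M law_Y) (\<lambda>(x, y). likelihood_ratio \<beta> r x y)"
proof (rule measure_eqI)
  show "sets (distr M (borel \<Otimes>\<^sub>M borel) (\<lambda>\<omega>. (X \<omega>, Y \<omega>)))
      = sets (density (law_X \<Otimes>\<^sub>M law_Y) (\<lambda>(x, y). likelihood_ratio \<beta> r x y))"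
    by (simp cong: sets_pair_measure_cong)
next
  fix A assume "A \<in> sets (distr M (borel \<Otimes>\<^sub>M borel) (\<lambda>\<omega>. (X \<omega>, Y \<omega>)))"
  then have [measurable]: "A \<in> sets (borel \<Otimes>\<^sub>M borel)" by simp
  have "emeasure (distr M (borel \<Otimes>\<^sub>M borel) (\<lambda>\<omega>. (X \<omega>, Y \<omega>))) A = (\<integral>\<^sup>+\<omega>. indicator A (X \<omega>, Y \<omega>) \<partial>M)"
    by (simp add: nn_integral_distr flip: nn_integral_indicator)
  also have "\<dots> = (\<integral>\<^sup>+x. \<integral>\<^sup>+y. ennreal (likelihood_ratio \<beta> r x y) * indicator A (x, y) \<partial>law_Y \<partial>law_X)"
    by (rule nn_integral_joint) measurable
  also have "\<dots> = (\<integral>\<^sup>+z. ennreal (likelihood_ratio \<beta> r (fst z) (snd z)) * indicator A z \<partial>(law_X \<Otimes>\<^sub>M law_Y))"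
    by (subst PY.nn_integral_fst[symmetric]) (auto simp: case_prod_unfold)
  also have "\<dots> = emeasure (density (law_X \<Otimes>\<^sub>M law_Y) (\<lambda>(x, y). likelihood_ratio \<beta> r x y)) A"
    by (subst emeasure_density) (auto simp: case_prod_unfold)
  finally show "emeasure (distr M (borel \<Otimes>\<^sub>M borel) (\<lambda>\<omega>. (X \<omega>, Y \<omega>))) A
      = emeasure (density (law_X \<Otimes>\<^sub>M law_Y) (\<lambda>(x, y). likelihood_ratio \<beta> r x y)) A" .
qed

lemma mutual_info_eq:
  "mutual_info M X Y = (\<integral>\<omega>. ln (likelihood_ratio \<beta> r (X \<omega>) (Y \<omega>)) \<partial>M)"
proof -
  have pos: "0 \<le> likelihood_ratio \<beta> r x y" for x y
    using likelihood_ratio_pos[OF r, of \<beta> x y] by simp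
  have "mutual_info M X Y
      = (\<integral>z. (\<lambda>(x, y). likelihood_ratio \<beta> r x y) z * log (exp 1) ((\<lambda>(x, y). likelihood_ratio \<beta> r x y) z) \<partial>(law_X \<Otimes>\<^sub>M law_Y))"
    unfolding mutual_info_def mutual_information_def distr_X distr_Y distr_XY
    by (rule PXY.KL_density) (auto simp: pos case_prod_unfold)
  also have "\<dots> = (\<integral>z. log (exp 1) ((\<lambda>(x, y). likelihood_ratio \<beta> r x y) z) \<partial>distr M (borel \<Otimes>\<^sub>M borel) (\<lambda>\<omega>. (X \<omega>, Y \<omega>)))"
    unfolding distr_XY by (subst integral_real_density) (auto simp: pos case_prod_unfold)
  also have "\<dots> = (\<integral>\<omega>. ln (likelihood_ratio \<beta> r (X \<omega>) (Y \<omega>)) \<partial>M)"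
    by (subst integral_distr) (auto simp: log_def case_prod_unfold)
  finally show ?thesis .
qed

end

section \<open>Bounds for the mutual information\<close>

text \<open>
  The lower bound is \<open>cosh z \<ge> exp z / 2\<close>. The upper bound starts from \<open>cosh z \<le> exp \<bar>z\<bar>\<close>. Passing from
  \<open>\<bar>z\<bar>\<close> to \<open>z\<close> costs twice the negative part, and \<open>z < 0\<close> only when the noise \<open>n\<close> is below \<open>- a\<close>;
  as \<open>- a (a + n)\<close> never exceeds \<open>n\<^sup>2 / 4\<close>, the cost is at most \<open>\<beta> n\<^sup>2\<close>, uniformly in the signal \<open>a\<close>.
\<close>

lemma ln_cosh_bounds:
  fixes a n \<beta> :: real
  assumes "\<beta> > 0" "a \<ge> 0"
  shows "2 * \<beta> * a * (a + n) - ln 2 \<le> ln (cosh (2 * \<beta> * a * (a + n)))"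
    and "ln (cosh (2 * \<beta> * a * (a + n))) \<le> 2 * \<beta> * a * (a + n) + \<beta> * n\<^sup>2"
proof -
  define z where "z = 2 * \<beta> * a * (a + n)"
  have "exp z / 2 \<le> cosh z"
    by (simp add: cosh_def)
  then have "ln (exp z / 2) \<le> ln (cosh z)"
    by simp
  then show "2 * \<beta> * a * (a + n) - ln 2 \<le> ln (cosh (2 * \<beta> * a * (a + n)))"
    by (simp add: ln_div flip: z_def)
  have "cosh z \<le> exp \<bar>z\<bar>"
    by (auto simp: cosh_def abs_if)
  then have "ln (cosh z) \<le> ln (exp \<bar>z\<bar>)"
    by (subst ln_le_cancel_iff) simp_all
  also have "\<dots> \<le> z + \<beta> * n\<^sup>2"
  proof (cases "z \<ge> 0")
    case False
    have "0 \<le> \<beta> * (2 * a + n)\<^sup>2" using assms by simp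
    also have "\<dots> = 2 * z + \<beta> * n\<^sup>2" by (simp add: z_def power2_eq_square algebra_simps)
    finally show ?thesis using False by simp
  qed (use assms in simp)
  finally show "ln (cosh (2 * \<beta> * a * (a + n))) \<le> 2 * \<beta> * a * (a + n) + \<beta> * n\<^sup>2"
    by (simp add: z_def)
qed

lemma ln_likelihood_ratio:
  assumes "r > 0" "x \<ge> 0" and y: "y = (sqrt (r * x) + n)\<^sup>2"
  shows "ln (likelihood_ratio \<beta> r x y) = ln (1 + r) / 2 - \<beta> * r * x - \<beta> * r / (1 + r) * y
     + ln (cosh (2 * \<beta> * sqrt (r * x) * (sqrt (r * x) + n)))"
proof -
  have "sqrt (r * x * y) = \<bar>sqrt (r * x) * (sqrt (r * x) + n)\<bar>"
    using assms(1,2) by (simp add: y real_sqrt_mult abs_mult)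
  then have c: "cosh (2 * \<beta> * sqrt (r * x * y)) = cosh (2 * \<beta> * sqrt (r * x) * (sqrt (r * x) + n))"
    using cosh_mult_abs[of "2 * \<beta>" "sqrt (r * x) * (sqrt (r * x) + n)"] by (simp only: mult.assoc)
  show ?thesis
    unfolding likelihood_ratio_def c using assms(1)
    by (simp add: ln_mult ln_sqrt)
qed

context gamma_channel
begin

lemma X_moment: "integrable M X" "expectation X = 1 / (2 * \<beta>)"
proof -
  define \<sigma> where "\<sigma> = 1 / sqrt (2 * \<beta>)"
  have \<sigma>: "\<sigma> > 0" "\<sigma>\<^sup>2 = 1 / (2 * \<beta>)" using \<beta> by (simp_all add: \<sigma>_def power_divide)
  have "has_bochner_integral lborel (\<lambda>u. normal_density 0 \<sigma> u * u\<^sup>2) (1 / (2 * \<beta>))"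
    using normal_moment_even[OF \<sigma>(1), of 0 1] \<beta> by (simp add: \<sigma>(2))
  then have "integrable law_X (\<lambda>x. x)" "integral\<^sup>L law_X (\<lambda>x. x) = 1 / (2 * \<beta>)"
    unfolding squared_normal_def \<sigma>_def[symmetric]
    by (auto simp: integrable_distr_eq integral_distr integrable_real_density integral_real_density
        has_bochner_integral_iff)
  then show "integrable M X" "expectation X = 1 / (2 * \<beta>)"
    unfolding distr_X[symmetric] by (auto simp: integrable_distr_eq integral_distr)
qed

lemma N_moments:
  "integrable M N" "expectation N = 0" "integrable M (\<lambda>\<omega>. (N \<omega>)\<^sup>2)" "expectation (\<lambda>\<omega>. (N \<omega>)\<^sup>2) = 1"
proof -
  show "integrable M N"
    by (rule distributed_integrable_var[OF N]) (use integrable_std_normal_moment[of 1] in auto)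
  show "expectation N = 0"
    by (rule standard_normal_distributed_expectation[OF N])
  show "integrable M (\<lambda>\<omega>. (N \<omega>)\<^sup>2)"
    using integrable_std_normal_moment[of 2]
    by (subst distributed_integrable[OF N, symmetric]) auto
  show "expectation (\<lambda>\<omega>. (N \<omega>)\<^sup>2) = 1"
    using integral_std_normal_moment_even[of 1]
    by (subst distributed_integral[OF N, symmetric]) auto
qed

lemma integrable_sqrt_X: "integrable M (\<lambda>\<omega>. sqrt (X \<omega>))"
proof (rule Bochner_Integration.integrable_bound)
  show "integrable M (\<lambda>\<omega>. 1 + X \<omega>)" using X_moment by simp
  show "AE \<omega> in M. norm (sqrt (X \<omega>)) \<le> norm (1 + X \<omega>)"
    using X_nonneg
  proof eventually_elim
    fix \<omega> assume "0 \<le> X \<omega>"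
    moreover have "0 \<le> (sqrt (X \<omega>) - 1 / 2)\<^sup>2" by simp
    ultimately show "norm (sqrt (X \<omega>)) \<le> norm (1 + X \<omega>)"
      by (simp add: power2_eq_square algebra_simps)
  qed
qed measurable

text \<open>
  The noise is centred and independent of the signal. Hence the terms linear in the noise vanish
  in mean.
\<close>

lemma cross_moment:
  "integrable M (\<lambda>\<omega>. sqrt (X \<omega>) * N \<omega>)" "expectation (\<lambda>\<omega>. sqrt (X \<omega>) * N \<omega>) = 0"
proof -
  have ind: "indep_var borel (\<lambda>\<omega>. sqrt (X \<omega>)) borel N"
  proof -
    have "indep_var borel (sqrt \<circ> X) borel ((\<lambda>x. x) \<circ> N)"
      by (rule indep_var_compose[OF indep]) measurable
    then show ?thesis unfolding comp_def .
  qed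
  show "integrable M (\<lambda>\<omega>. sqrt (X \<omega>) * N \<omega>)"
    by (rule indep_var_integrable[OF ind integrable_sqrt_X N_moments(1)])
  show "expectation (\<lambda>\<omega>. sqrt (X \<omega>) * N \<omega>) = 0"
    using indep_var_lebesgue_integral[OF ind integrable_sqrt_X N_moments(1)] N_moments(2) by simp
qed

text \<open>
  The logarithm of the likelihood ratio with \<open>ln (cosh z)\<close> replaced by
  \<open>z = 2 \<beta> sqrt (r X) (sqrt (r X) + N / sqrt (2 \<beta>))\<close>. It is the logarithm
  of the ratio between the Gaussian density of \<open>sqrt (r x) + N / sqrt (2 \<beta>)\<close> and the centred Gaussian
  density whose square has the output law, that is, of the ratio before squaring merges two signs.
  Being almost surely a polynomial in \<open>sqrt X\<close> and \<open>N\<close>, it has an explicit mean.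
\<close>

definition linear_log_ratio :: "'a \<Rightarrow> real" where
  "linear_log_ratio \<omega> = ln (1 + r) / 2 - \<beta> * r * X \<omega> - \<beta> * r / (1 + r) * Y \<omega>
     + 2 * \<beta> * (r * X \<omega> + sqrt r / sqrt (2 * \<beta>) * (sqrt (X \<omega>) * N \<omega>))"

lemma linear_log_ratio:
  "integrable M linear_log_ratio" "expectation linear_log_ratio = ln (1 + r) / 2"
proof -
  define c d where "c = sqrt r / sqrt (2 * \<beta>)" and "d = \<beta> * r / (1 + r)"
  have Y: "AE \<omega> in M. Y \<omega> = r * X \<omega> + 2 * c * (sqrt (X \<omega>) * N \<omega>) + (N \<omega>)\<^sup>2 / (2 * \<beta>)"
    using X_nonneg
  proof eventually_elim
    fix \<omega> assume "0 \<le> X \<omega>"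
    then show "Y \<omega> = r * X \<omega> + 2 * c * (sqrt (X \<omega>) * N \<omega>) + (N \<omega>)\<^sup>2 / (2 * \<beta>)"
      using \<beta> r by (simp add: Y_def power2_sum power_divide power_mult_distrib real_sqrt_mult c_def)
  qed
  have lin: "linear_log_ratio \<omega> = ln (1 + r) / 2 - \<beta> * r * X \<omega> - d * Y \<omega> + 2 * \<beta> * (r * X \<omega> + c * (sqrt (X \<omega>) * N \<omega>))" for \<omega>
    by (simp add: linear_log_ratio_def c_def d_def)
  define L where "L \<omega> = ln (1 + r) / 2 + (\<beta> * r - d * r) * X \<omega>
      + (2 * \<beta> * c - d * (2 * c)) * (sqrt (X \<omega>) * N \<omega>) + (- d / (2 * \<beta>)) * (N \<omega>)\<^sup>2" for \<omega>
  have AE_L: "AE \<omega> in M. linear_log_ratio \<omega> = L \<omega>"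
    using Y by eventually_elim (simp add: lin L_def algebra_simps)
  have "has_bochner_integral M L (ln (1 + r) / 2 + (\<beta> * r - d * r) * (1 / (2 * \<beta>))
      + (2 * \<beta> * c - d * (2 * c)) * 0 + (- d / (2 * \<beta>)) * 1)"
    unfolding L_def
    by (intro has_bochner_integral_add has_bochner_integral_mult_right)
       (auto simp: has_bochner_integral_iff X_moment N_moments cross_moment prob_space)
  also have "ln (1 + r) / 2 + (\<beta> * r - d * r) * (1 / (2 * \<beta>))
      + (2 * \<beta> * c - d * (2 * c)) * 0 + (- d / (2 * \<beta>)) * 1 = ln (1 + r) / 2"
    using \<beta> r by (simp add: d_def divide_simps) (simp add: algebra_simps)
  finally have L: "has_bochner_integral M L (ln (1 + r) / 2)" .
  have "linear_log_ratio \<in> borel_measurable M"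
    unfolding linear_log_ratio_def[abs_def] by measurable
  moreover have "L \<in> borel_measurable M"
    unfolding L_def[abs_def] by measurable
  ultimately have "has_bochner_integral M linear_log_ratio (ln (1 + r) / 2)"
    using has_bochner_integral_cong_AE[OF _ _ AE_L] L by blast
  then show "integrable M linear_log_ratio" "expectation linear_log_ratio = ln (1 + r) / 2"
    by (auto simp: has_bochner_integral_iff)
qed

text \<open>
  The random variable \<open>linear_log_ratio\<close> has mean \<open>ln (1 + r) / 2\<close>, and the error terms of
  \<open>ln_cosh_bounds\<close> have means \<open>ln 2\<close> and \<open>1/2\<close>. Together the bounds provide the
  integrability without which the integral giving the mutual information would be 0 by convention.
\<close>

lemma mutual_info_bounds:
  "ln (1 + r) / 2 - ln 2 \<le> mutual_info M X Y" "mutual_info M X Y \<le> ln (1 + r) / 2 + 1 / 2"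
proof -
  define k where "k \<omega> = ln (likelihood_ratio \<beta> r (X \<omega>) (Y \<omega>))" for \<omega>
  have [measurable]: "k \<in> borel_measurable M" unfolding k_def[abs_def] by measurable
  have bounds: "AE \<omega> in M. linear_log_ratio \<omega> - ln 2 \<le> k \<omega> \<and> k \<omega> \<le> linear_log_ratio \<omega> + (N \<omega>)\<^sup>2 / 2"
    using X_nonneg
  proof eventually_elim
    fix \<omega> assume X: "0 \<le> X \<omega>"
    define a n where "a = sqrt (r * X \<omega>)" and "n = N \<omega> / sqrt (2 * \<beta>)"
    have "a \<ge> 0" using r X by (simp add: a_def)
    have k: "k \<omega> = ln (1 + r) / 2 - \<beta> * r * X \<omega> - \<beta> * r / (1 + r) * Y \<omega> + ln (cosh (2 * \<beta> * a * (a + n)))"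
      unfolding k_def a_def by (rule ln_likelihood_ratio[OF r X]) (simp add: Y_def n_def)
    have an: "a * (a + n) = r * X \<omega> + sqrt r / sqrt (2 * \<beta>) * (sqrt (X \<omega>) * N \<omega>)"
      using r X by (simp add: a_def n_def distrib_left real_sqrt_mult power2_eq_square[symmetric]
          power_mult_distrib mult_ac)
    have lin: "linear_log_ratio \<omega> = ln (1 + r) / 2 - \<beta> * r * X \<omega> - \<beta> * r / (1 + r) * Y \<omega> + 2 * \<beta> * a * (a + n)"
      unfolding linear_log_ratio_def an[symmetric] by simp
    have n2: "\<beta> * n\<^sup>2 = (N \<omega>)\<^sup>2 / 2"
      using \<beta> by (simp add: n_def power_divide)
    show "linear_log_ratio \<omega> - ln 2 \<le> k \<omega> \<and> k \<omega> \<le> linear_log_ratio \<omega> + (N \<omega>)\<^sup>2 / 2"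
      using ln_cosh_bounds[OF \<beta> \<open>a \<ge> 0\<close>, of n] unfolding k lin n2 by simp
  qed
  have int_k: "integrable M k"
  proof (rule Bochner_Integration.integrable_bound)
    show "integrable M (\<lambda>\<omega>. \<bar>linear_log_ratio \<omega>\<bar> + ln 2 + (N \<omega>)\<^sup>2 / 2)"
      using linear_log_ratio(1) N_moments(3) by simp
    show "AE \<omega> in M. norm (k \<omega>) \<le> norm (\<bar>linear_log_ratio \<omega>\<bar> + ln 2 + (N \<omega>)\<^sup>2 / 2)"
      using bounds
    proof eventually_elim
      fix \<omega> assume "linear_log_ratio \<omega> - ln 2 \<le> k \<omega> \<and> k \<omega> \<le> linear_log_ratio \<omega> + (N \<omega>)\<^sup>2 / 2"
      moreover have "0 \<le> (N \<omega>)\<^sup>2 / 2" "0 \<le> ln (2::real)" by simp_all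
      ultimately show "norm (k \<omega>) \<le> norm (\<bar>linear_log_ratio \<omega>\<bar> + ln 2 + (N \<omega>)\<^sup>2 / 2)"
        unfolding real_norm_def by linarith
    qed
  qed measurable
  have "expectation (\<lambda>\<omega>. linear_log_ratio \<omega> - ln 2) \<le> expectation k"
    using bounds by (intro integral_mono_AE) (auto simp: linear_log_ratio int_k)
  then show "ln (1 + r) / 2 - ln 2 \<le> mutual_info M X Y"
    by (simp add: linear_log_ratio prob_space mutual_info_eq k_def[abs_def])
  have "expectation k \<le> expectation (\<lambda>\<omega>. linear_log_ratio \<omega> + (N \<omega>)\<^sup>2 / 2)"
    using bounds by (intro integral_mono_AE) (auto simp: linear_log_ratio int_k N_moments)
  then show "mutual_info M X Y \<le> ln (1 + r) / 2 + 1 / 2"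
    by (simp add: linear_log_ratio N_moments mutual_info_eq k_def[abs_def])
qed

end

section \<open>The asymptotics of the mutual information\<close>

theorem mainTheorem5:
  fixes M :: "'a measure" and X N :: "'a \<Rightarrow> real" and \<beta> :: real
    and Xr :: "real \<Rightarrow> 'a \<Rightarrow> real"
  assumes "prob_space M"
    and "\<beta> > 0"
    and "distributed M lborel X (gamma_density (1/2) \<beta>)"
    and "distributed M lborel N std_normal_density"
    and "prob_space.indep_var M borel X borel N"
    and "\<And>r \<omega>. r > 0 \<Longrightarrow> Xr r \<omega> = (sqrt (r * X \<omega>) + N \<omega> / sqrt (2 * \<beta>))\<^sup>2"
  shows "(\<forall>r>0. mutual_info M X (Xr r) \<ge> 1/2 * ln (1 + r) - ln 2) \<and>
         ((\<lambda>r. mutual_info M X (Xr r) / (1/2 * ln (1 + r))) \<longlongrightarrow> 1) at_top"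
proof -
  have bounds: "1/2 * ln (1 + r) - ln 2 \<le> mutual_info M X (Xr r)"
    "mutual_info M X (Xr r) \<le> 1/2 * ln (1 + r) + 1/2" if "r > 0" for r
  proof -
    interpret channel: gamma_channel M X N \<beta> r
      by (rule gamma_channel.intro[OF assms(1) gamma_channel_axioms.intro[OF assms(2) that assms(3-5)]])
    have "Xr r = channel.Y"
      using assms(6)[OF that] by (simp add: fun_eq_iff channel.Y_def)
    then show "1/2 * ln (1 + r) - ln 2 \<le> mutual_info M X (Xr r)"
      "mutual_info M X (Xr r) \<le> 1/2 * ln (1 + r) + 1/2"
      using channel.mutual_info_bounds by simp_all
  qed
  have "((\<lambda>r. mutual_info M X (Xr r) / (1/2 * ln (1 + r))) \<longlongrightarrow> 1) at_top"
  proof (rule tendsto_sandwich)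
    show "((\<lambda>r::real. (1/2 * ln (1 + r) - ln 2) / (1/2 * ln (1 + r))) \<longlongrightarrow> 1) at_top"
      by real_asymp
    show "((\<lambda>r::real. (1/2 * ln (1 + r) + 1/2) / (1/2 * ln (1 + r))) \<longlongrightarrow> 1) at_top"
      by real_asymp
    show "\<forall>\<^sub>F r in at_top. (1/2 * ln (1 + r) - ln 2) / (1/2 * ln (1 + r)) \<le> mutual_info M X (Xr r) / (1/2 * ln (1 + r))"
      using eventually_gt_at_top[of 0]
      by eventually_elim (intro divide_right_mono bounds, auto)
    show "\<forall>\<^sub>F r in at_top. mutual_info M X (Xr r) / (1/2 * ln (1 + r)) \<le> (1/2 * ln (1 + r) + 1/2) / (1/2 * ln (1 + r))"
      using eventually_gt_at_top[of 0]
      by eventually_elim (intro divide_right_mono bounds, auto)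
  qed
  then show ?thesis using bounds by simp
qed

end
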